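(* Let $q=2$ and let $r>1$ be an integer. Then $$\zeta_A(1)\,\zeta_A(1,2,2^2,\dots,2^{r-1})=\zeta_A(1,3,2^2,\dots,2^{r-1})+\zeta_A(1,1,2,\dots,2^{r-2})^2.$$ Furthermore, $$\zeta_A(1,3,2^2,\dots,2^{r-1})=\frac{[r]-1}{L_1[r]}\cdot\frac{1}{\prod_{k=1}^{r-2}[k]^{2^{r-k}}}\cdot\frac{\tilde\pi^{2^r}}{L_1^{2^r}}=\frac{[r]-1}{L_1[r]}\cdot\frac{1}{\prod_{k=1}^{r-2}[k]^{2^{r-k}}}\,\zeta_A(2^r).$$
   Context: $A=\mathbb{F}_2[\theta]$, $A_+$ the monic polynomials, $[k]=\theta^{2^k}-\theta$, $L_k=[k][k-1]\cdots[1]$. For $s\in\mathbb{Z}$, $d\ge0$ let $S_d(s)=\sum_{a\in A_+,\deg a=d}a^{-s}$. For positive integers $s_1,\dots,s_r$, $\zeta_A(s_1,\dots,s_r)=\sum_{d_1>\cdots>d_r\ge0}S_{d_1}(s_1)\cdots S_{d_r}(s_r)$, and $\zeta_A(k)=\sum_{a\in A_+}a^{-k}$. The tuples are $(1,2^0,2^1,\dots,2^{r-1})$ with first entry $1$ replaced appropriately: $(1,2,\dots,2^{r-1})=(2^0,2^1,\dots,2^{r-1})$, $(1,3,2^2,\dots,2^{r-1})$ has depth $r$, and $(1,1,2,\dots,2^{r-2})=(1,2^0,2^1,\dots,2^{r-2})$ has depth $r$. $\tilde\pi=(-\theta)^{2}\prod_{i\ge1}(1-\theta^{1-2^i})^{-1}$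 is a fundamental period of the Carlitz module. Empty products are $1$. *)

theory Defs
  imports
    "HOL-Analysis.Analysis"
    "HOL-Library.Z2"
    "HOL-Computational_Algebra.Formal_Laurent_Series"
begin

text \<open>
  The base field \<open>\<F>\<^sub>2\<close> is \<^typ>\<open>bit\<close>, and \<open>A = \<F>\<^sub>2[\<theta>]\<close> is \<^typ>\<open>bit poly\<close>.
  All series and products live in \<open>\<F>\<^sub>2((1/\<theta>))\<close>, the completion of \<open>\<F>\<^sub>2(\<theta>)\<close> at the
  infinite place, which is \<^typ>\<open>bit fls\<close> with the formal variable read as \<open>1/\<theta>\<close>;
  the metric of the type \<^typ>\<open>bit fls\<close> induces the \<open>1/\<theta>\<close>-adic topology.
\<close>

type_synonym K_inf = "bit fls"

definition \<theta> :: K_inf where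
  "\<theta> = fls_X_inv"

definition of_A :: "bit poly \<Rightarrow> K_inf" where
  "of_A a = poly (map_poly fls_const a) \<theta>"

definition A_plus :: "bit poly set" where
  "A_plus = {a. lead_coeff a = 1}"

definition bracket :: "nat \<Rightarrow> K_inf" where
  "bracket k = \<theta> ^ (2 ^ k) - \<theta>"

definition L :: "nat \<Rightarrow> K_inf" where
  "L k = (\<Prod>j = 1..k. bracket j)"

definition S :: "nat \<Rightarrow> int \<Rightarrow> K_inf" where
  "S d s = (\<Sum>a \<in> {a \<in> A_plus. degree a = d}. of_A a powi (- s))"

definition zeta_A :: "nat \<Rightarrow> K_inf" where
  "zeta_A k = (\<Sum>\<^sub>\<infinity>a \<in> A_plus. of_A a powi (- int k))"

text \<open>
  The index \<open>(s\<^sub>1, \<dots>, s\<^sub>r)\<close> is a list, and the sum ranges over the lists \<open>[d\<^sub>1, \<dots>, d\<^sub>r]\<close>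
  with \<open>d\<^sub>1 > \<dots> > d\<^sub>r \<ge> 0\<close>.
\<close>

definition mzeta_A :: "nat list \<Rightarrow> K_inf" where
  "mzeta_A ss =
     (\<Sum>\<^sub>\<infinity>ds \<in> {ds. length ds = length ss \<and> sorted_wrt (>) ds}.
        \<Prod>i < length ss. S (ds ! i) (int (ss ! i)))"

text \<open>The product over \<open>i \<ge> 1\<close> is indexed from \<open>0\<close>.\<close>

definition carlitz_period :: K_inf where
  "carlitz_period = (- \<theta>)\<^sup>2 * (\<Prod>i. inverse (1 - \<theta> powi (1 - 2 ^ Suc i)))"

end

theory Submission
  imports Defs
begin

text \<open>
  Write \<open>[n]\<close> for \<^term>\<open>bracket n\<close> and truncate all series at \<open>d\<^sub>1 < n\<close>.
  The linear polynomials \<open>e\<^sub>d(x) = \<Prod>(x + a)\<close>, \<open>deg a < d\<close>, give closed forms for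
  \<open>\<Sum> 1/(x + a)\<close> and \<open>\<Sum> 1/(x + a)\<^sup>3\<close>, and hence
  \<open>S\<^sub>d(2\<^sup>k) = 1/L\<^sub>d\<^bsup>2^k\<^esup>\<close> and \<open>S\<^sub>d(3) = S\<^sub>d(2) (S\<^sub>0(1) + \<dots> + S\<^sub>d(1))\<close>.
  The second formula says that the terms of \<open>\<zeta>(1) \<zeta>(1,2,4,\<dots>)\<close> with the index of the first
  factor at most \<open>d\<^sub>2\<close> add up to \<open>\<zeta>(1,3,4,\<dots>)\<close>; in the others that index and \<open>d\<^sub>1\<close> play symmetric
  roles, so in characteristic 2 only the diagonal \<open>\<zeta>(2,2,4,\<dots>) = \<zeta>(1,1,2,\<dots>)\<^sup>2\<close> survives.

  The truncations of \<open>\<zeta>(1,2,4,\<dots>)\<close> and \<open>\<zeta>(1,1,2,\<dots>)\<close> are products of powers of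
  \<open>[n] + [i]\<close> and \<open>L\<^sub>n\<close>, as the relation \<open>[n + 1] = [n]\<^sup>2 + [1]\<close> shows by induction.
  Since \<open>[n]\<^sup>2/L\<^sub>n = [1] (S\<^sub>0(1) + \<dots> + S\<^sub>n\<^sub>-\<^sub>1(1))\<close> tends both to \<open>[1] \<zeta>(1)\<close> and to the
  Carlitz period, all values become explicit multiples of powers of the period.
\<close>

unbundle fps_syntax

section \<open>Convergence of Laurent series\<close>

text \<open>Valuation at least \<open>N\<close>, stated through coefficients so that 0 qualifies for
  every \<open>N\<close>; since \<open>fls_subdegree 0 = 0\<close>, a bound on the subdegree would
  make 0 an exception.\<close>

definition fls_ord_ge :: "int \<Rightarrow> 'a::zero fls \<Rightarrow> bool" where
  "fls_ord_ge N x \<longleftrightarrow> (\<forall>k<N. x $$ k = 0)"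

lemma fls_ord_ge_mono: "fls_ord_ge N x \<Longrightarrow> M \<le> N \<Longrightarrow> fls_ord_ge M x"
  by (auto simp: fls_ord_ge_def)

lemma fls_ord_ge_0 [simp]: "fls_ord_ge N 0"
  by (auto simp: fls_ord_ge_def)

lemma fls_ord_ge_iff: "fls_ord_ge N x \<longleftrightarrow> x = 0 \<or> N \<le> fls_subdegree x"
  by (auto simp: fls_ord_ge_def intro: fls_subdegree_geI)

lemma fls_ord_ge_subdegree: "fls_ord_ge (fls_subdegree x) x"
  by (simp add: fls_ord_ge_iff)

lemma fls_ord_ge_add: "fls_ord_ge N x \<Longrightarrow> fls_ord_ge N y \<Longrightarrow> fls_ord_ge N (x + y)"
  for x y :: "'a::monoid_add fls"
  by (auto simp: fls_ord_ge_def)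

lemma fls_ord_ge_uminus: "fls_ord_ge N x \<Longrightarrow> fls_ord_ge N (- x)"
  for x :: "'a::group_add fls"
  by (auto simp: fls_ord_ge_def)

lemma fls_ord_ge_diff: "fls_ord_ge N x \<Longrightarrow> fls_ord_ge N y \<Longrightarrow> fls_ord_ge N (x - y)"
  for x y :: "'a::group_add fls"
  by (auto simp: fls_ord_ge_def)

lemma fls_ord_ge_sum: "(\<And>i. i \<in> I \<Longrightarrow> fls_ord_ge N (f i)) \<Longrightarrow> fls_ord_ge N (sum f I)"
  for f :: "'b \<Rightarrow> 'a::comm_monoid_add fls"
  by (induction I rule: infinite_finite_induct) (auto intro: fls_ord_ge_add)

lemma fls_ord_ge_mult:
  fixes x y :: "'a::{comm_monoid_add,mult_zero} fls"
  assumes "fls_ord_ge M x" "fls_ord_ge N y"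
  shows "fls_ord_ge (M + N) (x * y)"
proof (cases "x * y = 0")
  case False
  then have "x \<noteq> 0" "y \<noteq> 0" by auto
  with assms have "M \<le> fls_subdegree x" "N \<le> fls_subdegree y"
    by (auto simp: fls_ord_ge_iff)
  then show ?thesis
    using fls_mult_subdegree_ge[OF False] by (simp add: fls_ord_ge_iff)
qed simp

lemma fls_ord_ge_prod:
  "(\<And>i. i \<in> I \<Longrightarrow> fls_ord_ge (n i) (f i)) \<Longrightarrow> fls_ord_ge (\<Sum>i\<in>I. n i) (\<Prod>i\<in>I. f i)"
  for f :: "'b \<Rightarrow> 'a::comm_ring_1 fls"
proof (induction I rule: infinite_finite_induct)
  case (insert i I)
  then show ?case by (simp add: fls_ord_ge_mult)
qed (simp_all add: fls_ord_ge_def)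

text \<open>A difference of negative valuation has distance above 1, so it lies outside every ball
  of radius \<open>inverse (2 ^ n)\<close>; on the rest the distance is 2 to minus the
  valuation.\<close>

lemma dist_fls_le_iff_ord_ge:
  fixes a b :: "'a::group_add fls"
  shows "dist a b \<le> inverse (2 ^ n) \<longleftrightarrow> fls_ord_ge (int n) (a - b)"
proof (cases "a = b")
  case False
  show ?thesis
  proof (cases "fls_subdegree (a - b) \<ge> 0")
    case True
    with False show ?thesis
      by (auto simp: dist_fls_def fls_ord_ge_iff)
  next
    case neg: False
    have "inverse (2 ^ n) \<le> (1::real)"
      by (simp add: inverse_le_1_iff)
    moreover have "(1::real) < 2 ^ nat (- fls_subdegree (a - b))"
      using neg by (intro one_less_power) auto
    moreover have "dist a b = 2 ^ nat (- fls_subdegree (a - b))"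
      using neg False by (simp add: dist_fls_def)
    ultimately have "\<not> dist a b \<le> inverse (2 ^ n)"
      by linarith
    with neg False show ?thesis
      by (auto simp: fls_ord_ge_iff)
  qed
qed (simp add: dist_fls_def)

lemma tendsto_fls_iff_ord_ge:
  fixes f :: "'b \<Rightarrow> 'a::group_add fls"
  shows "(f \<longlongrightarrow> l) F \<longleftrightarrow> (\<forall>N. \<forall>\<^sub>F x in F. fls_ord_ge N (f x - l))"
proof
  assume lim: "(f \<longlongrightarrow> l) F"
  show "\<forall>N. \<forall>\<^sub>F x in F. fls_ord_ge N (f x - l)"
  proof
    fix N
    have "\<forall>\<^sub>F x in F. dist (f x) l < inverse (2 ^ nat N)"
      using lim by (rule tendstoD) simp
    then show "\<forall>\<^sub>F x in F. fls_ord_ge N (f x - l)"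
    proof (rule eventually_mono)
      fix x assume "dist (f x) l < inverse (2 ^ nat N)"
      then have "fls_ord_ge (int (nat N)) (f x - l)"
        using dist_fls_le_iff_ord_ge less_imp_le by blast
      then show "fls_ord_ge N (f x - l)"
        by (rule fls_ord_ge_mono) simp
    qed
  qed
next
  assume ord: "\<forall>N. \<forall>\<^sub>F x in F. fls_ord_ge N (f x - l)"
  show "(f \<longlongrightarrow> l) F"
  proof (rule tendstoI)
    fix e :: real assume "e > 0"
    then obtain n where n: "inverse (2 ^ n) < e"
      using real_arch_pow_inv[of e "1 / 2"] by (auto simp: power_divide inverse_eq_divide)
    have "\<forall>\<^sub>F x in F. fls_ord_ge (int n) (f x - l)"
      using ord by blast
    then show "\<forall>\<^sub>F x in F. dist (f x) l < e"
    proof (rule eventually_mono)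
      fix x assume "fls_ord_ge (int n) (f x - l)"
      then have "dist (f x) l \<le> inverse (2 ^ n)"
        by (simp only: dist_fls_le_iff_ord_ge)
      with n show "dist (f x) l < e" by linarith
    qed
  qed
qed

instance fls :: (ab_group_add) topological_ab_group_add
proof
  fix a b :: "'a fls"
  have "(fst \<longlongrightarrow> a) (nhds a \<times>\<^sub>F nhds b)" "(snd \<longlongrightarrow> b) (nhds a \<times>\<^sub>F nhds b)"
    by (rule filterlim_fst filterlim_snd)+
  then have *: "\<forall>\<^sub>F x in nhds a \<times>\<^sub>F nhds b. fls_ord_ge N (fst x - a)"
    "\<forall>\<^sub>F x in nhds a \<times>\<^sub>F nhds b. fls_ord_ge N (snd x - b)" for N
    by (simp_all add: tendsto_fls_iff_ord_ge)
  have "\<forall>\<^sub>F x in nhds a \<times>\<^sub>F nhds b. fls_ord_ge N (fst x + snd x - (a + b))" for N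
    using *[of N] by eventually_elim (simp add: add_diff_add fls_ord_ge_add)
  then show "LIM x nhds a \<times>\<^sub>F nhds b. fst x + snd x :> nhds (a + b)"
    by (simp add: tendsto_fls_iff_ord_ge)
next
  fix a :: "'a fls"
  have "((\<lambda>x. x) \<longlongrightarrow> a) (nhds a)"
    by (rule filterlim_ident)
  then have *: "\<forall>\<^sub>F x in nhds a. fls_ord_ge N (x - a)" for N
    by (simp add: tendsto_fls_iff_ord_ge)
  have "\<forall>\<^sub>F x in nhds a. fls_ord_ge N (- x - - a)" for N
    using *[of N] by eventually_elim (simp only: minus_diff_minus fls_ord_ge_uminus)
  then show "(uminus \<longlongrightarrow> - a) (nhds a)"
    by (simp add: tendsto_fls_iff_ord_ge)
qed

instance fls :: (comm_ring_1) topological_comm_monoid_mult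
proof
  fix a b :: "'a fls"
  let ?F = "nhds a \<times>\<^sub>F nhds b"
  have "(fst \<longlongrightarrow> a) ?F" "(snd \<longlongrightarrow> b) ?F"
    by (rule filterlim_fst filterlim_snd)+
  then have *: "\<forall>\<^sub>F x in ?F. fls_ord_ge N (fst x - a)" "\<forall>\<^sub>F x in ?F. fls_ord_ge N (snd x - b)" for N
    by (simp_all add: tendsto_fls_iff_ord_ge)
  \<comment> \<open>With x near a and y near b, the error is (x - a)(y - b) + (x - a) b + (y - b) a.
    The tolerances \<open>N\<close> and 0 serve the first product; for the other two,
    \<open>N\<close> is lowered by the subdegree of the fixed factor.\<close>
  have "\<forall>\<^sub>F x in ?F. fls_ord_ge N (fst x * snd x - a * b)" for N
    using *(1)[of N] *(2)[of 0] *(1)[of "N - fls_subdegree b"] *(2)[of "N - fls_subdegree a"]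
  proof eventually_elim
    case (elim x)
    have "fls_ord_ge N ((fst x - a) * (snd x - b))"
      using fls_ord_ge_mult[OF elim(1,2)] by simp
    moreover have "fls_ord_ge N ((fst x - a) * b)"
      using fls_ord_ge_mult[OF elim(3) fls_ord_ge_subdegree[of b]] by simp
    moreover have "fls_ord_ge N ((snd x - b) * a)"
      using fls_ord_ge_mult[OF elim(4) fls_ord_ge_subdegree[of a]] by simp
    moreover have "fst x * snd x - a * b
        = (fst x - a) * (snd x - b) + (fst x - a) * b + (snd x - b) * a"
      by (simp add: algebra_simps)
    ultimately show ?case
      by (simp add: fls_ord_ge_add)
  qed
  then show "LIM x ?F. fst x * snd x :> nhds (a * b)"
    by (simp add: tendsto_fls_iff_ord_ge)
qed

section \<open>Limits and unordered sums of Laurent series\<close>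

lemma fls_tendsto_0I:
  fixes f :: "nat \<Rightarrow> 'a::ab_group_add fls"
  assumes "\<And>n. n > 0 \<Longrightarrow> fls_ord_ge (int n) (f n)"
  shows "f \<longlonglongrightarrow> 0"
  unfolding tendsto_fls_iff_ord_ge
proof
  fix N
  have "fls_ord_ge N (f n)" if "n \<ge> Suc (nat N)" for n
    using that by (intro fls_ord_ge_mono[OF assms]) auto
  then show "\<forall>\<^sub>F n in sequentially. fls_ord_ge N (f n - 0)"
    by (auto simp: eventually_sequentially)
qed

lemma tendsto_power_fls: "(f \<longlongrightarrow> a) F \<Longrightarrow> ((\<lambda>x. f x ^ n) \<longlongrightarrow> a ^ n) F"
  for a :: "'a::comm_ring_1 fls"
  by (rule tendsto_power_strong[OF _ tendsto_const])

text \<open>In a nonarchimedean metric it suffices that the terms tend to 0: each coefficient of the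
  sum then receives only finitely many nonzero contributions, so the limit can be built
  coefficientwise.\<close>

lemma fls_summable_onI:
  fixes f :: "'b \<Rightarrow> 'a::ab_group_add fls"
  assumes fin: "\<And>N. finite {i \<in> A. \<not> fls_ord_ge N (f i)}"
  shows "f summable_on A"
proof -
  define B where "B N = {i \<in> A. \<not> fls_ord_ge N (f i)}" for N
  have finB: "finite (B N)" for N
    using fin by (simp add: B_def)
  \<comment> \<open>A common lower bound for the indices of nonzero coefficients, so that
    \<open>Abs_fls\<close> is applied to a genuine Laurent series; only terms in \<open>B 0\<close>
    have coefficients at negative indices.\<close>
  define M where "M = Min (insert 0 ((\<lambda>i. fls_subdegree (f i)) ` B 0))"
  have M: "f i $$ k = 0" if "i \<in> A" "k < M" for i k
  proof (cases "i \<in> B 0")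
    case True
    then have "M \<le> fls_subdegree (f i)"
      unfolding M_def using finB by (intro Min_le) auto
    with that show ?thesis by simp
  next
    case False
    moreover have "M \<le> 0"
      unfolding M_def using finB by (intro Min_le) auto
    ultimately show ?thesis
      using that by (auto simp: B_def fls_ord_ge_def)
  qed
  \<comment> \<open>Terms outside \<open>B (k + 1)\<close> have coefficient 0 at index
    \<open>k\<close>.\<close>
  define s where "s = Abs_fls (\<lambda>k. \<Sum>i\<in>B (k + 1). f i $$ k)"
  have s: "s $$ k = (\<Sum>i\<in>B (k + 1). f i $$ k)" for k
    unfolding s_def
    by (rule nth_Abs_fls_ex_lower_bound) (auto simp: B_def intro!: exI[of _ M] sum.neutral M)
  have "fls_ord_ge N (sum f C - s)" if C: "finite C" "B N \<subseteq> C" "C \<subseteq> A" for N C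
    unfolding fls_ord_ge_def
  proof (intro allI impI)
    fix k assume "k < N"
    then have "B (k + 1) \<subseteq> B N"
      unfolding B_def by (auto dest: fls_ord_ge_mono[of N _ "k + 1"])
    then have "(\<Sum>i\<in>C. f i $$ k) = (\<Sum>i\<in>B (k + 1). f i $$ k)"
      using C by (intro sum.mono_neutral_right) (auto simp: B_def fls_ord_ge_def)
    moreover have "sum f C $$ k = (\<Sum>i\<in>C. f i $$ k)"
      by (induction C rule: infinite_finite_induct) auto
    ultimately show "(sum f C - s) $$ k = 0"
      by (simp add: s)
  qed
  moreover have "B N \<subseteq> A" for N
    by (auto simp: B_def)
  ultimately have "\<forall>\<^sub>F C in finite_subsets_at_top A. fls_ord_ge N (sum f C - s)" for N
    unfolding eventually_finite_subsets_at_top using finB by (intro exI[of _ "B N"]) auto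
  then have "(f has_sum s) A"
    by (simp add: has_sum_def tendsto_fls_iff_ord_ge)
  then show ?thesis
    by (rule has_sum_imp_summable)
qed

lemma infsum_tendsto_incseq:
  fixes f :: "'b \<Rightarrow> 'a::{comm_monoid_add,t2_space}"
  assumes "f summable_on A" "\<And>n. finite (B n)" "mono B" "(\<Union>n. B n) = A"
  shows "(\<lambda>n. sum f (B n)) \<longlonglongrightarrow> infsum f A"
proof -
  have "filterlim B (finite_subsets_at_top A) sequentially"
    unfolding filterlim_finite_subsets_at_top
  proof (intro allI impI)
    fix X assume "finite X \<and> X \<subseteq> A"
    \<comment> \<open>A finite subset of the union of a chain already lies in one member.\<close>
    moreover have "subset.chain UNIV (range B)"
      unfolding subset_chain_def using linorder_linear monoD[OF assms(3)] by (metis UNIV_I image_iff subsetI)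
    ultimately obtain n where "X \<subseteq> B n"
      using finite_subset_Union_chain[of X "range B" UNIV] assms(4)
      by (metis UNIV_not_empty image_iff image_is_empty)
    then have "X \<subseteq> B m" if "m \<ge> n" for m
      using monoD[OF assms(3) that] by blast
    then show "\<forall>\<^sub>F m in sequentially. finite (B m) \<and> X \<subseteq> B m \<and> B m \<subseteq> A"
      using assms(2,4) by (auto simp: eventually_sequentially intro!: exI[of _ n])
  qed
  with infsum_tendsto[OF assms(1)] show ?thesis
    by (rule filterlim_compose)
qed

section \<open>Characteristic 2 and brackets\<close>

lemma K_inf_two_eq_0: "(2 :: K_inf) = 0"
proof -
  have "(1 + 1 :: K_inf) = 0"
    by (rule fls_eqI) (simp only: fls_plus_nth fls_one_nth, simp)
  then show ?thesis by simp
qed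

lemma K_inf_add_self [simp]: "x + x = (0 :: K_inf)"
  using K_inf_two_eq_0 by (metis mult_2 mult_zero_left)

lemma K_inf_add_cancel [simp]: "x + (x + y) = (y :: K_inf)"
  by (simp flip: add.assoc)

lemma K_inf_minus [simp]: "- x = (x :: K_inf)"
  by (metis K_inf_add_self minus_unique)

lemma K_inf_diff: "x - y = x + (y :: K_inf)"
  by (simp add: diff_conv_add_uminus del: add_uminus_conv_diff)

lemma K_inf_eqI_mod_2: "x = y + 2 * z \<Longrightarrow> x = (y :: K_inf)"
  by (simp add: K_inf_two_eq_0)

lemma K_inf_add_power2: "(x + y)\<^sup>2 = x\<^sup>2 + (y :: K_inf)\<^sup>2"
  by (simp add: power2_sum K_inf_two_eq_0)

lemma K_inf_sum_power2: "(\<Sum>i\<in>I. f i)\<^sup>2 = (\<Sum>i\<in>I. (f i :: K_inf)\<^sup>2)"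
  by (induction I rule: infinite_finite_induct) (auto simp: K_inf_add_power2)

lemma K_inf_sum_power_two_power: "(\<Sum>i\<in>I. f i) ^ (2 ^ k) = (\<Sum>i\<in>I. (f i :: K_inf) ^ (2 ^ k))"
proof (induction k)
  case (Suc k)
  then show ?case
    by (simp add: power_mult mult.commute[of 2] K_inf_sum_power2)
qed simp

lemma bracket_0 [simp]: "bracket 0 = 0"
  by (simp add: bracket_def)

text \<open>Squaring is additive, so it sends [k] to \<theta>^(2^(k+1)) - \<theta>^2; adding [1]
  corrects the last term.\<close>

lemma bracket_Suc: "bracket (Suc k) = (bracket k)\<^sup>2 + bracket 1"
  by (simp add: bracket_def K_inf_diff K_inf_add_power2 power_mult mult.commute[of 2] add_ac)
    (simp add: power2_eq_square)

lemma \<theta>_neq_0 [simp]: "\<theta> \<noteq> 0"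
  by (simp add: \<theta>_def)

lemma bracket_nth: "k > 0 \<Longrightarrow> bracket k $$ - (2 ^ k) = 1"
proof -
  assume "k > 0"
  then have "(2::int) ^ k \<noteq> 1" by simp
  moreover have "bracket k $$ - (2 ^ k) = (fls_X_inv ^ (2 ^ k) :: K_inf) $$ - (2 ^ k)
      - (fls_X_inv :: K_inf) $$ - (2 ^ k)"
    by (simp add: bracket_def \<theta>_def)
  ultimately show ?thesis by simp
qed

lemma bracket_neq_0 [simp]: "k > 0 \<Longrightarrow> bracket k \<noteq> 0"
  using bracket_nth[of k] by force

lemma L_0 [simp]: "L 0 = 1"
  by (simp add: L_def)

lemma L_Suc: "L (Suc k) = L k * bracket (Suc k)"
  by (simp add: L_def)

lemma L_neq_0 [simp]: "L k \<noteq> 0"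
  by (simp add: L_def)

section \<open>Power sums over monic polynomials\<close>

lemma of_A_nth: "of_A a $$ k = (if k \<le> 0 then coeff a (nat (- k)) else 0)"
proof -
  have "of_A a = (\<Sum>i\<le>degree a. fls_const (coeff a i) * fls_X_inv ^ i)"
    by (simp add: of_A_def \<theta>_def poly_altdef coeff_map_poly degree_map_poly)
  also have "\<dots> $$ k = (\<Sum>i\<le>degree a. coeff a i * (if k = - int i then 1 else 0))"
    by (simp add: fls_nth_sum)
  also have "\<dots> = (\<Sum>i\<le>degree a. if i = nat (- k) \<and> k \<le> 0 then coeff a i else 0)"
    by (intro sum.cong) auto
  also have "\<dots> = (if k \<le> 0 then coeff a (nat (- k)) else 0)"
    by (auto simp: coeff_eq_0)
  finally show ?thesis .
qed

lemma of_A_add: "of_A (a + b) = of_A a + of_A b"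
  by (rule fls_eqI) (simp add: of_A_nth)

lemma of_A_0 [simp]: "of_A 0 = 0"
  by (rule fls_eqI) (simp add: of_A_nth)

lemma of_A_monom: "of_A (monom 1 d) = \<theta> ^ d"
  by (rule fls_eqI) (auto simp: of_A_nth \<theta>_def)

lemma of_A_eq_0_iff [simp]: "of_A a = 0 \<longleftrightarrow> a = 0"
proof
  assume "of_A a = 0"
  then have "coeff a n = 0" for n
    using of_A_nth[of a "- int n"] by simp
  then show "a = 0" by (simp add: poly_eqI)
qed simp

lemma fls_subdegree_of_A: "a \<noteq> 0 \<Longrightarrow> fls_subdegree (of_A a) = - int (degree a)"
  by (rule fls_subdegree_eqI) (auto simp: of_A_nth coeff_eq_0)

text \<open>The condition on coefficients keeps 0 in the space for every \<open>d\<close>, whereas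
  \<open>degree a < d\<close> would leave it empty at \<open>d = 0\<close>.\<close>

definition A_deg_less :: "nat \<Rightarrow> bit poly set" where
  "A_deg_less d = {a. \<forall>i\<ge>d. coeff a i = 0}"

lemma A_deg_less_0: "A_deg_less 0 = {0}"
  by (auto simp: A_deg_less_def poly_eq_iff)

lemma A_deg_less_Suc: "A_deg_less (Suc d) = A_deg_less d \<union> (+) (monom 1 d) ` A_deg_less d"
proof (intro equalityI subsetI)
  fix a assume a: "a \<in> A_deg_less (Suc d)"
  show "a \<in> A_deg_less d \<union> (+) (monom 1 d) ` A_deg_less d"
  proof (cases "coeff a d = 0")
    case True
    have "coeff a i = 0" if "i \<ge> d" for i
      using a True that by (cases "i = d") (auto simp: A_deg_less_def)
    then show ?thesis
      by (simp add: A_deg_less_def)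
  next
    case False
    have "coeff (a - monom 1 d) i = 0" if "i \<ge> d" for i
      using a False that by (cases "i = d") (auto simp: A_deg_less_def)
    then have "a - monom 1 d \<in> A_deg_less d"
      by (simp add: A_deg_less_def)
    then show ?thesis
      by (intro UnI2 image_eqI[of _ _ "a - monom 1 d"]) auto
  qed
qed (auto simp: A_deg_less_def)

lemma A_deg_less_disjoint: "A_deg_less d \<inter> (+) (monom 1 d) ` A_deg_less d = {}"
  by (auto simp: A_deg_less_def)

lemma finite_A_deg_less [simp]: "finite (A_deg_less d)"
  by (induction d) (auto simp: A_deg_less_0 A_deg_less_Suc)

lemma A_plus_degree_eq: "{a \<in> A_plus. degree a = d} = (+) (monom 1 d) ` A_deg_less d"
proof (intro equalityI subsetI)
  fix a assume "a \<in> {a \<in> A_plus. degree a = d}"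
  then have "a - monom 1 d \<in> A_deg_less d"
    by (auto simp: A_plus_def A_deg_less_def coeff_eq_0)
  then show "a \<in> (+) (monom 1 d) ` A_deg_less d"
    by (intro image_eqI[of _ _ "a - monom 1 d"]) auto
next
  fix a assume "a \<in> (+) (monom 1 d) ` A_deg_less d"
  then have *: "coeff a d = 1" "\<And>i. i > d \<Longrightarrow> coeff a i = 0"
    by (auto simp: A_deg_less_def)
  then have "degree a = d"
    by (intro antisym degree_le le_degree) auto
  with * show "a \<in> {a \<in> A_plus. degree a = d}"
    by (simp add: A_plus_def)
qed

lemma S_eq: "S d s = (\<Sum>a\<in>A_deg_less d. (\<theta> ^ d + of_A a) powi - s)"
  unfolding S_def A_plus_degree_eq
  by (subst sum.reindex) (auto simp: of_A_add of_A_monom inj_on_def)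

lemma sum_A_deg_less_Suc:
  "(\<Sum>a\<in>A_deg_less (Suc d). g (x + of_A a)) =
    (\<Sum>a\<in>A_deg_less d. g (x + of_A a)) + (\<Sum>a\<in>A_deg_less d. g (x + \<theta> ^ d + of_A a))"
  for g :: "K_inf \<Rightarrow> K_inf"
proof -
  have "(\<Sum>a\<in>(+) (monom 1 d) ` A_deg_less d. g (x + of_A a))
      = (\<Sum>a\<in>A_deg_less d. g (x + \<theta> ^ d + of_A a))"
    by (subst sum.reindex) (auto simp: of_A_add of_A_monom inj_on_def add_ac)
  then show ?thesis
    unfolding A_deg_less_Suc using A_deg_less_disjoint[of d] by (subst sum.union_disjoint) auto
qed

text \<open>The linear polynomial \<open>e\<^sub>d(x) = \<Prod>(x + a)\<close>, the product running over all \<open>a\<close> with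
  \<open>deg a < d\<close>: separating the \<open>a\<close> according to their coefficient at \<open>\<theta>\<^sup>d\<close>
  gives \<open>e\<^sub>d\<^sub>+\<^sub>1(x) = e\<^sub>d(x) e\<^sub>d(x + \<theta>\<^sup>d)\<close>.\<close>

primrec carlitz_e :: "nat \<Rightarrow> K_inf \<Rightarrow> K_inf" where
  "carlitz_e 0 x = x"
| "carlitz_e (Suc d) x = carlitz_e d x * (carlitz_e d x + carlitz_e d (\<theta> ^ d))"

text \<open>Carlitz's D_d, the product of all monic polynomials of degree d.\<close>

definition carlitz_D :: "nat \<Rightarrow> K_inf" where
  "carlitz_D d = carlitz_e d (\<theta> ^ d)"

lemma carlitz_e_Suc: "carlitz_e (Suc d) x = (carlitz_e d x)\<^sup>2 + carlitz_D d * carlitz_e d x"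
  by (simp add: carlitz_D_def power2_eq_square algebra_simps)

lemma carlitz_e_add: "carlitz_e d (x + y) = carlitz_e d x + carlitz_e d y"
  by (induction d arbitrary: x y)
    (simp_all add: carlitz_e_Suc K_inf_add_power2 distrib_left add_ac del: carlitz_e.simps(2))

text \<open>The second identity is the first at \<open>x = \<theta> ^ d\<close>, which is a root of
  \<open>carlitz_e (Suc d)\<close>. The inductive step for the first identity uses the second one
  level below, hence the joint statement.\<close>

lemma carlitz_e_mult_\<theta>_D_Suc:
  "carlitz_e (Suc d) (\<theta> * x) = \<theta> * carlitz_e (Suc d) x + bracket (Suc d) * (carlitz_e d x)\<^sup>2 \<and>
   carlitz_D (Suc d) = bracket (Suc d) * (carlitz_D d)\<^sup>2"
proof -
  have D: "carlitz_D (Suc d) = bracket (Suc d) * (carlitz_D d)\<^sup>2"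
    if "\<And>x. carlitz_e (Suc d) (\<theta> * x) =
      \<theta> * carlitz_e (Suc d) x + bracket (Suc d) * (carlitz_e d x)\<^sup>2" for d
  proof -
    have "carlitz_e (Suc d) (\<theta> ^ d) = 0"
      by simp
    with that[of "\<theta> ^ d"] show ?thesis
      by (simp add: carlitz_D_def del: carlitz_e.simps)
  qed
  have e: "carlitz_e (Suc d) (\<theta> * x) =
      \<theta> * carlitz_e (Suc d) x + bracket (Suc d) * (carlitz_e d x)\<^sup>2" for x
  proof (induction d arbitrary: x)
    case 0
    show ?case
      by (simp add: bracket_def K_inf_diff power2_eq_square algebra_simps)
  next
    case (Suc d)
    define e where "e = carlitz_e d x"
    define e' where "e' = carlitz_e (Suc d) x"
    define b where "b = bracket (Suc d)"
    have e': "e' = e\<^sup>2 + carlitz_D d * e"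
      unfolding e'_def e_def by (rule carlitz_e_Suc)
    have "bracket (Suc (Suc d)) = b\<^sup>2 + bracket 1"
      unfolding b_def by (rule bracket_Suc)
    then have b': "bracket (Suc (Suc d)) = b\<^sup>2 + \<theta>\<^sup>2 + \<theta>"
      by (simp add: bracket_def K_inf_diff add_ac power2_eq_square)
    have D': "carlitz_D (Suc d) = b * (carlitz_D d)\<^sup>2"
      unfolding b_def by (rule D[OF Suc.IH])
    have "carlitz_e (Suc (Suc d)) (\<theta> * x)
        = (\<theta> * e' + b * e\<^sup>2)\<^sup>2 + carlitz_D (Suc d) * (\<theta> * e' + b * e\<^sup>2)"
      unfolding carlitz_e_Suc[of "Suc d"] Suc.IH by (simp only: e_def e'_def b_def)
    also have "\<dots> = \<theta> * (e'\<^sup>2 + carlitz_D (Suc d) * e') + (b\<^sup>2 + \<theta>\<^sup>2 + \<theta>) * e'\<^sup>2"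
      \<comment> \<open>The witness collects the cross terms of the two squares and the repeated
        \<open>\<theta> * e'\<^sup>2\<close>.\<close>
      by (rule K_inf_eqI_mod_2[where z = "\<theta> * e' * b * e\<^sup>2 - \<theta> * e'\<^sup>2 - b\<^sup>2 * carlitz_D d * e ^ 3"])
        (unfold D' e', algebra)
    also have "\<dots> = \<theta> * carlitz_e (Suc (Suc d)) x + bracket (Suc (Suc d)) * e'\<^sup>2"
      unfolding carlitz_e_Suc[of "Suc d"] b' by (simp only: e'_def)
    finally show ?case
      by (simp only: e'_def)
  qed
  show ?thesis
    using e D[OF e] by blast
qed

lemmas carlitz_D_Suc = carlitz_e_mult_\<theta>_D_Suc[THEN conjunct2]

lemma carlitz_D_0 [simp]: "carlitz_D 0 = 1"
  by (simp add: carlitz_D_def)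

lemma carlitz_D_neq_0 [simp]: "carlitz_D d \<noteq> 0"
  by (induction d) (auto simp: carlitz_D_Suc)

text \<open>The product is the coefficient of x in the linear polynomial e_d, hence its derivative.
  Divided by e_d(\<theta>^d) = D_d, it becomes 1/L_d.\<close>

lemma prod_carlitz_D: "(\<Prod>i<d. carlitz_D i) = carlitz_D d / L d"
proof (induction d)
  case (Suc d)
  then show ?case
    by (simp add: carlitz_D_Suc L_Suc power2_eq_square)
qed simp

text \<open>The inductive step for sums of inverse cubes: \<open>E\<close> and \<open>E + D\<close>
  are the values of e_d at x and x + \<theta>^d, \<open>k\<close> is the coefficient of x in e_d,
  and \<open>T\<close> is the sum of the earlier 1/L_i. With F = E + D one has D = E + F, and the
  symmetric expressions in E and F reduce to D and EF.\<close>

lemma inverse_cubes_K_inf: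
  fixes E D k T :: K_inf
  assumes "E \<noteq> 0" "E + D \<noteq> 0" "D \<noteq> 0"
  shows "k ^ 3 / E ^ 3 + k\<^sup>2 * T / E\<^sup>2 + (k ^ 3 / (E + D) ^ 3 + k\<^sup>2 * T / (E + D)\<^sup>2)
    = (k * D) ^ 3 / (E * (E + D)) ^ 3 + (k * D)\<^sup>2 * (T + k / D) / (E * (E + D))\<^sup>2"
proof -
  define F where "F = E + D"
  have D: "D = E + F"
    by (simp add: F_def)
  have nz: "E \<noteq> 0" "F \<noteq> 0" "D \<noteq> 0"
    using assms by (auto simp: F_def)
  have cube: "E ^ 3 + F ^ 3 = D ^ 3 + D * E * F"
    by (rule K_inf_eqI_mod_2[where z = "- 2 * (E\<^sup>2 * F + E * F\<^sup>2)"]) (unfold D, algebra)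
  have square: "E\<^sup>2 + F\<^sup>2 = D\<^sup>2"
    by (simp add: D K_inf_add_power2)
  have "k ^ 3 / E ^ 3 + k\<^sup>2 * T / E\<^sup>2 + (k ^ 3 / F ^ 3 + k\<^sup>2 * T / F\<^sup>2)
      = k ^ 3 * (E ^ 3 + F ^ 3) / (E * F) ^ 3 + k\<^sup>2 * T * (E\<^sup>2 + F\<^sup>2) / (E * F)\<^sup>2"
    using nz by (simp add: divide_simps) algebra
  also have "\<dots> = (k * D) ^ 3 / (E * F) ^ 3 + (k * D)\<^sup>2 * (T + k / D) / (E * F)\<^sup>2"
    unfolding cube square using nz by (simp add: divide_simps) algebra
  finally show ?thesis
    by (simp only: F_def)
qed

text \<open>The first sum is the logarithmic derivative of e_d, whose derivative is constant. Both
  sums are found by splitting off the coefficient at \<theta>^d: on the second half e_d(x) is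
  replaced by e_d(x) + D_d, and each step adds 1/L_d to the correction in the cubic sum.\<close>

lemma sum_inverse_A_deg_less:
  assumes "\<And>a. a \<in> A_deg_less d \<Longrightarrow> x + of_A a \<noteq> 0"
  shows "carlitz_e d x \<noteq> 0 \<and>
    (\<Sum>a\<in>A_deg_less d. 1 / (x + of_A a)) = (\<Prod>i<d. carlitz_D i) / carlitz_e d x \<and>
    (\<Sum>a\<in>A_deg_less d. 1 / (x + of_A a) ^ 3) =
      (\<Prod>i<d. carlitz_D i) ^ 3 / carlitz_e d x ^ 3
      + (\<Prod>i<d. carlitz_D i)\<^sup>2 * (\<Sum>i<d. 1 / L i) / (carlitz_e d x)\<^sup>2"
  using assms
proof (induction d arbitrary: x)
  case 0
  then show ?case by (simp add: A_deg_less_0)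
next
  case (Suc d)
  define E where "E = carlitz_e d x"
  define D where "D = carlitz_D d"
  define k where "k = (\<Prod>i<d. carlitz_D i)"
  define T where "T = (\<Sum>i<d. 1 / L i)"
  have shift: "carlitz_e d (x + \<theta> ^ d) = E + D"
    by (simp add: E_def D_def carlitz_e_add carlitz_D_def)
  have Suc_e: "carlitz_e (Suc d) x = E * (E + D)"
    by (simp add: E_def D_def carlitz_D_def)
  have IH1: "E \<noteq> 0" "(\<Sum>a\<in>A_deg_less d. 1 / (x + of_A a)) = k / E"
    "(\<Sum>a\<in>A_deg_less d. 1 / (x + of_A a) ^ 3) = k ^ 3 / E ^ 3 + k\<^sup>2 * T / E\<^sup>2"
    using Suc.IH[of x] Suc.prems by (auto simp: E_def D_def k_def T_def A_deg_less_Suc)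
  have "x + \<theta> ^ d + of_A a \<noteq> 0" if "a \<in> A_deg_less d" for a
    using Suc.prems[of "monom 1 d + a"] that
    by (auto simp: A_deg_less_Suc of_A_add of_A_monom add_ac)
  from Suc.IH[OF this] have IH2: "E + D \<noteq> 0"
    "(\<Sum>a\<in>A_deg_less d. 1 / (x + \<theta> ^ d + of_A a)) = k / (E + D)"
    "(\<Sum>a\<in>A_deg_less d. 1 / (x + \<theta> ^ d + of_A a) ^ 3)
      = k ^ 3 / (E + D) ^ 3 + k\<^sup>2 * T / (E + D)\<^sup>2"
    by (auto simp: shift k_def T_def)
  have D: "D \<noteq> 0" "k / D = 1 / L d"
    by (auto simp: D_def k_def prod_carlitz_D)
  have "k / E + k / (E + D) = k * (E + (E + D)) / (E * (E + D))"
    using IH1(1) IH2(1) by (simp add: divide_simps) (simp add: distrib_left add_ac)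
  then have "(\<Sum>a\<in>A_deg_less (Suc d). 1 / (x + of_A a)) = k * D / (E * (E + D))"
    by (simp add: sum_A_deg_less_Suc[where g = "\<lambda>y. 1 / y"] IH1 IH2)
  moreover have "(\<Sum>a\<in>A_deg_less (Suc d). 1 / (x + of_A a) ^ 3)
      = (k * D) ^ 3 / (E * (E + D)) ^ 3 + (k * D)\<^sup>2 * (T + 1 / L d) / (E * (E + D))\<^sup>2"
    unfolding sum_A_deg_less_Suc[where g = "\<lambda>y. 1 / y ^ 3"] IH1 IH2
    using inverse_cubes_K_inf[OF IH1(1) IH2(1) D(1), of k T] by (simp only: D(2))
  moreover have "(\<Prod>i<Suc d. carlitz_D i) = k * D" "(\<Sum>i<Suc d. 1 / L i) = T + 1 / L d"
    by (simp_all add: k_def D_def T_def)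
  ultimately show ?case
    unfolding Suc_e using IH1(1) IH2(1) by auto
qed

lemma \<theta>_power_add_of_A_neq_0: "a \<in> A_deg_less d \<Longrightarrow> \<theta> ^ d + of_A a \<noteq> 0"
proof -
  assume "a \<in> A_deg_less d"
  then have "monom 1 d + a \<noteq> 0"
    by (auto simp: A_deg_less_def poly_eq_iff intro!: exI[of _ d])
  then show ?thesis
    using of_A_eq_0_iff by (metis of_A_add of_A_monom)
qed

lemma S_1: "S d 1 = 1 / L d"
  using sum_inverse_A_deg_less[OF \<theta>_power_add_of_A_neq_0, of d]
  by (simp add: S_eq power_int_minus inverse_eq_divide prod_carlitz_D flip: carlitz_D_def)

text \<open>At x = \<theta>^d the pure cubic term is 1/L_d^3, which supplies the summand i = d; this
  makes the inner range i \<le> d rather than i < d.\<close>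

lemma S_3: "S d 3 = (\<Sum>i<Suc d. 1 / L i) / (L d)\<^sup>2"
proof -
  have "S d 3 = (\<Prod>i<d. carlitz_D i) ^ 3 / carlitz_D d ^ 3
      + (\<Prod>i<d. carlitz_D i)\<^sup>2 * (\<Sum>i<d. 1 / L i) / (carlitz_D d)\<^sup>2"
    using sum_inverse_A_deg_less[OF \<theta>_power_add_of_A_neq_0, of d]
    by (simp add: S_eq power_int_minus inverse_eq_divide flip: carlitz_D_def)
  also have "\<dots> = 1 / L d ^ 3 + (\<Sum>i<d. 1 / L i) / (L d)\<^sup>2"
    by (simp add: prod_carlitz_D power_divide)
  also have "\<dots> = (\<Sum>i<Suc d. 1 / L i) / (L d)\<^sup>2"
    by (simp add: add_divide_distrib power2_eq_square power3_eq_cube add_ac)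
  finally show ?thesis .
qed

lemma S_double: "S d (2 * s) = (S d s)\<^sup>2"
proof -
  have "y powi - (2 * s) = (y powi - s)\<^sup>2" for y :: K_inf
    by (metis mult.commute mult_minus_left power_int_mult power_int_numeral)
  then show ?thesis
    by (simp add: S_def K_inf_sum_power2)
qed

lemma S_two_power: "S d (2 ^ k) = 1 / L d ^ (2 ^ k)"
proof (induction k)
  case (Suc k)
  then show ?case
    using S_double[of d "2 ^ k"] by (simp add: power_divide flip: power_mult) (simp add: mult.commute)
qed (simp add: S_1)

text \<open>Telescopes, since [n]^2 + [1] = [n+1] and [n+1]/L_n = [n+1]^2/L_{n+1}.\<close>

lemma sum_inverse_L: "bracket 1 * (\<Sum>d<n. 1 / L d) = (bracket n)\<^sup>2 / L n"
proof (induction n)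
  case (Suc n)
  have "bracket 1 * (\<Sum>d<Suc n. 1 / L d) = (bracket n)\<^sup>2 / L n + bracket 1 / L n"
    using Suc by (simp add: distrib_left)
  also have "\<dots> = bracket (Suc n) / L n"
    by (simp add: bracket_Suc[of n] add_divide_distrib)
  also have "\<dots> = (bracket (Suc n))\<^sup>2 / L (Suc n)"
    by (simp add: L_Suc power2_eq_square)
  finally show ?case .
qed simp

section \<open>Truncated multiple zeta values\<close>

lemma fls_ord_ge_of_A_powi:
  assumes "a \<in> A_plus" "s \<ge> 1"
  shows "fls_ord_ge (int (degree a)) (of_A a powi - int s)"
proof -
  have "a \<noteq> 0"
    using assms by (auto simp: A_plus_def)
  moreover have "int (degree a) \<le> int s * int (degree a)"
    using assms(2) by (cases s) (auto simp: algebra_simps)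
  ultimately show ?thesis
    by (simp add: fls_ord_ge_iff power_int_minus fls_inverse_subdegree fls_subdegree_pow
        fls_subdegree_of_A)
qed

lemma fls_ord_ge_S: "s \<ge> 1 \<Longrightarrow> fls_ord_ge (int d) (S d (int s))"
  unfolding S_def by (rule fls_ord_ge_sum) (use fls_ord_ge_of_A_powi in force)

definition decreasing_lists :: "nat \<Rightarrow> nat \<Rightarrow> nat list set" where
  "decreasing_lists r n = {ds. length ds = r \<and> sorted_wrt (>) ds \<and> set ds \<subseteq> {..<n}}"

lemma finite_decreasing_lists [simp]: "finite (decreasing_lists r n)"
  by (rule finite_subset[OF _ finite_lists_length_eq[of "{..<n}" r]])
    (auto simp: decreasing_lists_def)

lemma decreasing_lists_Suc:
  "decreasing_lists (Suc r) n = (\<lambda>x. fst x # snd x) ` (SIGMA d:{..<n}. decreasing_lists r d)"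
proof (intro equalityI subsetI)
  fix ds assume "ds \<in> decreasing_lists (Suc r) n"
  then obtain d ds' where "ds = d # ds'" "d < n" "ds' \<in> decreasing_lists r d"
    by (cases ds) (auto simp: decreasing_lists_def)
  then show "ds \<in> (\<lambda>x. fst x # snd x) ` (SIGMA d:{..<n}. decreasing_lists r d)"
    by force
next
  fix ds assume "ds \<in> (\<lambda>x. fst x # snd x) ` (SIGMA d:{..<n}. decreasing_lists r d)"
  then show "ds \<in> decreasing_lists (Suc r) n"
    by (force simp: decreasing_lists_def)
qed

text \<open>The outer index becomes the bound for the tail, so the sum runs over n > d_1 > ... > d_r
  \<ge> 0.\<close>

primrec mzeta_trunc :: "nat list \<Rightarrow> nat \<Rightarrow> K_inf" where
  "mzeta_trunc [] n = 1"
| "mzeta_trunc (s # ss) n = (\<Sum>d<n. S d (int s) * mzeta_trunc ss d)"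

lemma sum_decreasing_lists:
  "(\<Sum>ds\<in>decreasing_lists (length ss) n. \<Prod>i<length ss. S (ds ! i) (int (ss ! i))) = mzeta_trunc ss n"
proof (induction ss arbitrary: n)
  case Nil
  have "decreasing_lists 0 n = {[]}"
    by (auto simp: decreasing_lists_def)
  then show ?case by simp
next
  case (Cons s ss)
  have inj: "inj_on (\<lambda>x. fst x # snd x) X" for X :: "(nat \<times> nat list) set"
    by (auto simp: inj_on_def)
  have "(\<Sum>ds\<in>decreasing_lists (length (s # ss)) n.
        \<Prod>i<length (s # ss). S (ds ! i) (int ((s # ss) ! i)))
      = (\<Sum>d<n. \<Sum>ds\<in>decreasing_lists (length ss) d.
          S d (int s) * (\<Prod>i<length ss. S (ds ! i) (int (ss ! i))))"
    by (simp add: decreasing_lists_Suc sum.reindex[OF inj] sum.Sigma split_def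
        prod.lessThan_Suc_shift del: prod.lessThan_Suc)
  also have "\<dots> = mzeta_trunc (s # ss) n"
    by (simp add: Cons.IH flip: sum_distrib_left)
  finally show ?case .
qed

text \<open>The term of (d_1, ..., d_r) has valuation at least d_1 + ... + d_r. Only lists with all
  entries below \<open>N\<close> can fail to reach valuation \<open>N\<close>, which gives
  summability; the truncations are partial sums along an exhaustion.\<close>

lemma mzeta_trunc_tendsto:
  assumes "\<And>s. s \<in> set ss \<Longrightarrow> s \<ge> 1"
  shows "mzeta_trunc ss \<longlonglongrightarrow> mzeta_A ss"
proof -
  define A where "A = {ds :: nat list. length ds = length ss \<and> sorted_wrt (>) ds}"
  define f where "f ds = (\<Prod>i<length ss. S (ds ! i) (int (ss ! i)))" for ds
  have "{ds \<in> A. \<not> fls_ord_ge N (f ds)} \<subseteq> decreasing_lists (length ss) (nat N)" for N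
  proof
    fix ds assume ds: "ds \<in> {ds \<in> A. \<not> fls_ord_ge N (f ds)}"
    have ord: "fls_ord_ge (\<Sum>i<length ss. int (ds ! i)) (f ds)"
      unfolding f_def using assms by (intro fls_ord_ge_prod fls_ord_ge_S) auto
    have "d < nat N" if d: "d \<in> set ds" for d
    proof (rule ccontr)
      assume "\<not> d < nat N"
      moreover obtain i where i: "i < length ss" "d = ds ! i"
        using d ds by (auto simp: in_set_conv_nth A_def)
      ultimately have "N \<le> int (ds ! i)"
        by linarith
      also have "\<dots> \<le> (\<Sum>i<length ss. int (ds ! i))"
        using i by (intro member_le_sum) auto
      finally show False
        using fls_ord_ge_mono[OF ord] ds by blast
    qed
    with ds show "ds \<in> decreasing_lists (length ss) (nat N)"
      by (auto simp: decreasing_lists_def A_def)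
  qed
  then have "f summable_on A"
    by (intro fls_summable_onI) (rule finite_subset[OF _ finite_decreasing_lists])
  moreover have "mono (decreasing_lists (length ss))"
    by (rule monoI) (auto simp: decreasing_lists_def)
  moreover have "(\<Union>n. decreasing_lists (length ss) n) = A"
  proof (intro equalityI subsetI)
    fix ds assume "ds \<in> A"
    moreover obtain n where "set ds \<subseteq> {..<n}"
      using finite_nat_bounded[of "set ds"] by auto
    ultimately show "ds \<in> (\<Union>n. decreasing_lists (length ss) n)"
      by (auto simp: A_def decreasing_lists_def)
  qed (auto simp: A_def decreasing_lists_def)
  ultimately have "(\<lambda>n. sum f (decreasing_lists (length ss) n)) \<longlonglongrightarrow> infsum f A"
    by (intro infsum_tendsto_incseq) auto
  then show ?thesis
    by (simp add: f_def[abs_def] A_def sum_decreasing_lists mzeta_A_def)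
qed

lemma zeta_A_tendsto:
  assumes "k \<ge> 1"
  shows "(\<lambda>n. \<Sum>d<n. S d (int k)) \<longlonglongrightarrow> zeta_A k"
proof -
  define B where "B n = {a \<in> A_plus. degree a < n}" for n
  have fin: "finite (B n)" for n
  proof (rule finite_subset)
    show "B n \<subseteq> A_deg_less n"
      by (auto simp: B_def A_deg_less_def coeff_eq_0)
  qed simp
  define f where "f a = of_A a powi - int k" for a
  have "{a \<in> A_plus. \<not> fls_ord_ge N (f a)} \<subseteq> B (nat N)" for N
  proof
    fix a assume a: "a \<in> {a \<in> A_plus. \<not> fls_ord_ge N (f a)}"
    then have "fls_ord_ge (int (degree a)) (f a)"
      unfolding f_def using assms by (intro fls_ord_ge_of_A_powi) auto
    with a have "\<not> N \<le> int (degree a)"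
      using fls_ord_ge_mono by blast
    with a show "a \<in> B (nat N)"
      by (auto simp: B_def)
  qed
  with fin have "f summable_on A_plus"
    by (intro fls_summable_onI) (blast intro: finite_subset)
  moreover have "mono B"
    by (rule monoI) (auto simp: B_def)
  moreover have "(\<Union>n. B n) = A_plus"
    by (auto simp: B_def)
  ultimately have "(\<lambda>n. sum f (B n)) \<longlonglongrightarrow> infsum f A_plus"
    using fin by (intro infsum_tendsto_incseq)
  moreover have "sum f (B n) = (\<Sum>d<n. S d (int k))" for n
  proof -
    have "{a \<in> B n. degree a = d} = {a \<in> A_plus. degree a = d}" if "d < n" for d
      using that by (auto simp: B_def)
    then have "(\<Sum>d<n. S d (int k)) = (\<Sum>d<n. sum f {a \<in> B n. degree a = d})"
      by (simp add: S_def f_def)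
    also have "\<dots> = sum f (B n)"
      using fin by (intro sum.group) (auto simp: B_def)
    finally show ?thesis by simp
  qed
  ultimately show ?thesis
    by (simp add: zeta_A_def f_def[abs_def])
qed

section \<open>Algebraic relations between truncations\<close>

lemma mzeta_trunc_double: "mzeta_trunc (map ((*) 2) ss) n = (mzeta_trunc ss n)\<^sup>2"
  by (induction ss arbitrary: n) (simp_all add: K_inf_sum_power2 power_mult_distrib S_double)

lemma mzeta_trunc_Cons_Suc:
  "mzeta_trunc (s # ss) (Suc n) = mzeta_trunc (s # ss) n + S n (int s) * mzeta_trunc ss n"
  by simp

lemma mzeta_trunc_1: "mzeta_trunc [1] n = (\<Sum>d<n. 1 / L d)"
  by (simp add: S_1)

lemma S_2: "S d 2 = 1 / (L d)\<^sup>2"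
  using S_two_power[of d 1] by simp

text \<open>By \<open>S_3\<close>, the left side collects the pairs i \<le> d of the product of the
  1-sum with the (2, ss)-sum. The pairs i > d form the (1, 2, ss)-sum, and adding that sum removes
  them in characteristic 2.\<close>

lemma mzeta_trunc_3_Cons:
  "mzeta_trunc (3 # ss) n = mzeta_trunc (1 # 2 # ss) n + mzeta_trunc [1] n * mzeta_trunc (2 # ss) n"
proof (induction n)
  case (Suc n)
  define s where "s = 1 / L n"
  have S3: "S n 3 = s\<^sup>2 * (mzeta_trunc [1] n + s)"
    unfolding S_3 mzeta_trunc_1 by (simp add: s_def power_divide)
  define t where "t = mzeta_trunc [1] n"
  define f where "f = mzeta_trunc (1 # 2 # ss) n"
  define h where "h = mzeta_trunc (2 # ss) n"
  define x where "x = mzeta_trunc ss n"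
  have "mzeta_trunc (3 # ss) (Suc n) = f + t * h + s\<^sup>2 * (t + s) * x"
    unfolding mzeta_trunc_Cons_Suc Suc by (simp only: of_nat_numeral S3 t_def f_def h_def x_def)
  also have "\<dots> = f + s * h + (t + s) * (h + s\<^sup>2 * x)"
    by (rule K_inf_eqI_mod_2[where z = "- s * h"]) algebra
  also have "\<dots> = mzeta_trunc (1 # 2 # ss) (Suc n)
      + mzeta_trunc [1] (Suc n) * mzeta_trunc (2 # ss) (Suc n)"
    unfolding mzeta_trunc_Cons_Suc
    by (simp add: S_1 S_2 t_def f_def h_def x_def s_def power_divide)
  finally show ?case .
qed simp

text \<open>Passing from n to n + 1 changes the product by s (f + t h) + s^2 h, where s = 1/L_n. By
  the preceding lemma f + t h is the (3, ss)-sum, and s^2 h is the increment of the (2, 2,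
  ss)-sum.\<close>

lemma mzeta_trunc_1_mult:
  "mzeta_trunc [1] n * mzeta_trunc (1 # 2 # ss) n
    = mzeta_trunc (1 # 3 # ss) n + mzeta_trunc (2 # 2 # ss) n"
proof (induction n)
  case (Suc n)
  define s where "s = 1 / L n"
  have S: "S n (int 1) = s" "S n (int 2) = s\<^sup>2"
    by (simp_all add: S_1 S_2 s_def power_divide)
  define t where "t = mzeta_trunc [1] n"
  define f where "f = mzeta_trunc (1 # 2 # ss) n"
  define h where "h = mzeta_trunc (2 # ss) n"
  have "mzeta_trunc [1] (Suc n) * mzeta_trunc (1 # 2 # ss) (Suc n) = (t + s) * (f + s * h)"
    unfolding mzeta_trunc_Cons_Suc S by (simp add: t_def f_def h_def)
  also have "\<dots> = t * f + s * (f + t * h) + s\<^sup>2 * h"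
    by algebra
  also have "\<dots> = mzeta_trunc (1 # 3 # ss) (Suc n) + mzeta_trunc (2 # 2 # ss) (Suc n)"
    using Suc unfolding mzeta_trunc_Cons_Suc[of _ "_ # _"] S mzeta_trunc_3_Cons
    by (simp only: t_def f_def h_def add_ac)
  finally show ?case .
qed simp

section \<open>Closed forms of the truncations\<close>

text \<open>The product form of \<open>carlitz_D\<close>, with the same recursion and initial value;
  its powers have the shape of the denominator in the theorem.\<close>

definition bracket_tower :: "nat \<Rightarrow> K_inf" where
  "bracket_tower r = (\<Prod>k = 1..r. bracket k ^ (2 ^ (r - k)))"

lemma bracket_tower_power: "bracket_tower r ^ 2 ^ m = (\<Prod>k = 1..r. bracket k ^ (2 ^ (r + m - k)))"
  unfolding bracket_tower_def prod_power_distrib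
  by (intro prod.cong) (simp_all flip: power_mult power_add)

lemma bracket_tower_Suc: "bracket_tower (Suc r) = (bracket_tower r)\<^sup>2 * bracket (Suc r)"
  using bracket_tower_power[of r 1] by (simp add: bracket_tower_def[of "Suc r"])

lemma bracket_tower_neq_0 [simp]: "bracket_tower r \<noteq> 0"
  by (simp add: bracket_tower_def)

text \<open>
  Up to constants and powers of \<open>[n]\<close>, this is the numerator of the truncations of
  \<open>\<zeta>(1,2,\<dots>,2\<^sup>r)\<close> and \<open>\<zeta>(1,1,2,\<dots>,2\<^sup>r)\<close>; note that \<open>[n] + [i] = \<theta>\<^bsup>2^n\<^esup> + \<theta>\<^bsup>2^i\<^esup>\<close>.
\<close>

primrec bracket_prod :: "nat \<Rightarrow> nat \<Rightarrow> K_inf" where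
  "bracket_prod 0 n = 1"
| "bracket_prod (Suc r) n = (bracket_prod r n * (bracket n + bracket (Suc r)))\<^sup>2"

lemma bracket_add_power2: "(bracket n + bracket m)\<^sup>2 = bracket (Suc n) + bracket (Suc m)"
  by (simp add: K_inf_add_power2 bracket_Suc[of n] bracket_Suc[of m] add_ac)

lemma power_two_Suc: "x ^ 2 ^ Suc k = (x ^ 2 ^ k)\<^sup>2" for x :: "'a::monoid_mult"
  by (simp add: mult.commute flip: power_mult)

text \<open>Each [n+1] + [i] equals ([n] + [i-1])^2, so raising n shifts the indices by one. The
  factor i = 1 turns into the power of [n], and the extra factor on the left supplies the top
  index.\<close>

lemma bracket_prod_Suc_arg:
  "bracket_prod r (Suc n) * (bracket (Suc n) + bracket (Suc r)) = bracket n ^ 2 ^ Suc r * bracket_prod r n"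
proof (induction r)
  case 0
  show ?case using bracket_add_power2[of n 0] by simp
next
  case (Suc r)
  have "bracket_prod (Suc r) (Suc n) * (bracket (Suc n) + bracket (Suc (Suc r)))
      = (bracket_prod r (Suc n) * (bracket (Suc n) + bracket (Suc r)))\<^sup>2 * (bracket n + bracket (Suc r))\<^sup>2"
    by (simp add: bracket_add_power2)
  also have "\<dots> = (bracket n ^ 2 ^ Suc r)\<^sup>2 * bracket_prod (Suc r) n"
    unfolding Suc by (simp add: power_mult_distrib)
  also have "\<dots> = bracket n ^ 2 ^ Suc (Suc r) * bracket_prod (Suc r) n"
    by (simp only: power_two_Suc[of _ "Suc r"])
  finally show ?case .
qed

lemma bracket_1_power: "bracket 1 ^ 2 ^ k = bracket (Suc k) + bracket k"
proof (induction k)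
  case (Suc k)
  then show ?case
    by (simp only: power_two_Suc bracket_add_power2)
qed simp

abbreviation (input) two_powers :: "nat \<Rightarrow> nat list" where
  "two_powers r \<equiv> map (\<lambda>i. 2 ^ i) [0..<r]"

text \<open>Exposes the tail as a doubled list, so that its truncation is a square by
  \<open>mzeta_trunc_double\<close>.\<close>

lemma two_powers_Suc: "two_powers (Suc r) = 1 # map ((*) 2) (two_powers r)"
  by (simp add: map_upt_Suc comp_def del: upt_Suc)

text \<open>Induction on \<open>r\<close> and, inside, on \<open>n\<close>: the increment in
  \<open>n\<close> is 1/L_n times the square of the truncation for the smaller \<open>r\<close>.
  Denominators are cleared, and at \<open>n = 0\<close> both sides vanish because [0] = 0.\<close>

lemma mzeta_trunc_two_powers:
  "mzeta_trunc (two_powers (Suc r)) n * bracket_tower (Suc r) * L n ^ 2 ^ Suc r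
    = L n * bracket n ^ 2 ^ Suc r * bracket_prod r n"
proof (induction r arbitrary: n)
  case 0
  show ?case
    using sum_inverse_L[of n]
    by (simp add: S_1 bracket_tower_def power2_eq_square divide_simps mult_ac)
next
  case (Suc r)
  note outer = Suc.IH
  show ?case
  proof (induction n)
    case 0
    show ?case by (simp add: two_powers_Suc[of "Suc r"] del: upt_Suc)
  next
    case (Suc n)
    define X where "X = mzeta_trunc (two_powers (Suc (Suc r))) n"
    define f where "f = mzeta_trunc (two_powers (Suc r)) n"
    define l where "l = L n"
    define M where "M = (2::nat) ^ Suc (Suc r)"
    define b where "b = bracket n"
    define b' where "b' = bracket (Suc n)"
    define q where "q = bracket_prod r n"
    define c where "c = bracket_tower (Suc r)"
    have l: "l \<noteq> 0" by (simp add: l_def)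
    have f: "(f * c)\<^sup>2 * l ^ M = l\<^sup>2 * b ^ M * q\<^sup>2"
      using arg_cong[OF outer[of n], of "\<lambda>x. x\<^sup>2"]
      unfolding power_mult_distrib power_two_Suc[of _ "Suc r", symmetric]
      by (simp only: f_def c_def l_def M_def b_def q_def power_mult_distrib)
    have X: "X * bracket_tower (Suc (Suc r)) * l ^ M = l * b ^ M * (q * (b + bracket (Suc r)))\<^sup>2"
      using Suc by (simp only: X_def l_def M_def b_def q_def bracket_prod.simps)
    have q': "bracket_prod (Suc r) (Suc n) = b ^ M * q\<^sup>2"
      unfolding bracket_prod.simps bracket_prod_Suc_arg power_mult_distrib
        power_two_Suc[of _ "Suc r", symmetric] by (simp only: b_def M_def q_def)
    \<comment> \<open>After extraction of the common factors, the old truncation contributes ([n] +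
      [r+1])^2 and the increment contributes [r+2]; together they give the [n+1] that turns L_n into
      L_{n+1}.\<close>
    have b': "b' = (b + bracket (Suc r))\<^sup>2 + bracket (Suc (Suc r))"
      unfolding bracket_add_power2 b_def b'_def by (simp add: add.assoc)
    have "mzeta_trunc (two_powers (Suc (Suc r))) (Suc n) = X + f\<^sup>2 / l"
      unfolding X_def two_powers_Suc[of "Suc r"] mzeta_trunc_Cons_Suc mzeta_trunc_double
      by (simp add: S_1 f_def l_def)
    then have "mzeta_trunc (two_powers (Suc (Suc r))) (Suc n) * bracket_tower (Suc (Suc r))
        * L (Suc n) ^ M
      = (X * bracket_tower (Suc (Suc r)) * l ^ M
          + ((f * c)\<^sup>2 * l ^ M) * bracket (Suc (Suc r)) / l) * b' ^ M"
      by (simp add: L_Suc bracket_tower_Suc[of "Suc r"] power_mult_distrib algebra_simps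
          flip: l_def b'_def c_def)
    also have "\<dots> = l * b' * b' ^ M * (b ^ M * q\<^sup>2)"
      unfolding X f using l
      by (subst b'[THEN arg_cong[where f = "\<lambda>x. l * x * b' ^ M * (b ^ M * q\<^sup>2)"]])
        (simp add: power2_eq_square algebra_simps)
    also have "\<dots> = L (Suc n) * bracket (Suc n) ^ M * bracket_prod (Suc r) (Suc n)"
      unfolding q' by (simp only: L_Suc l_def b'_def)
    finally show ?case
      by (simp only: M_def)
  qed
qed

text \<open>Here induction on \<open>n\<close> suffices, as the increment is 1/L_n times the
  truncation just evaluated.\<close>

lemma mzeta_trunc_1_two_powers:
  "mzeta_trunc (1 # two_powers (Suc r)) n * (bracket 1 ^ 2 ^ Suc r * bracket_tower (Suc r))
      * L n ^ 2 ^ Suc r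
    = bracket n ^ 2 ^ Suc r * bracket_prod r n * (bracket n + bracket (Suc r))\<^sup>2"
proof (induction n)
  case 0
  show ?case by simp
next
  case (Suc n)
  define X where "X = mzeta_trunc (1 # two_powers (Suc r)) n"
  define f where "f = mzeta_trunc (two_powers (Suc r)) n"
  define l where "l = L n"
  define M where "M = (2::nat) ^ Suc r"
  define b where "b = bracket n"
  define b' where "b' = bracket (Suc n)"
  define q where "q = bracket_prod r n"
  define c where "c = bracket_tower (Suc r)"
  have l: "l \<noteq> 0" by (simp add: l_def)
  have f: "f * c * l ^ M = l * b ^ M * q"
    using mzeta_trunc_two_powers[of r n]
    by (simp only: f_def c_def l_def M_def b_def q_def)
  have X: "X * (bracket 1 ^ M * c) * l ^ M = b ^ M * q * (b + bracket (Suc r))\<^sup>2"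
    using Suc by (simp only: X_def c_def l_def M_def b_def q_def)
  have q': "bracket_prod r (Suc n) * (b' + bracket (Suc r)) = b ^ M * q"
    unfolding b'_def bracket_prod_Suc_arg by (simp only: b_def M_def q_def)
  \<comment> \<open>The square is [n+1] + [r+2] and [1]^M is [r+2] + [r+1]. The result is one factor
    of the new square; \<open>q'\<close> supplies the other.\<close>
  have b': "(b + bracket (Suc r))\<^sup>2 + bracket 1 ^ M = b' + bracket (Suc r)"
    unfolding bracket_add_power2 b_def b'_def M_def bracket_1_power by (simp add: add_ac)
  have "mzeta_trunc (1 # two_powers (Suc r)) (Suc n) = X + f / l"
    unfolding X_def mzeta_trunc_Cons_Suc
    by (simp add: S_1 f_def l_def)
  then have "mzeta_trunc (1 # two_powers (Suc r)) (Suc n) * (bracket 1 ^ M * c) * L (Suc n) ^ M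
    = (X * (bracket 1 ^ M * c) * l ^ M + (f * c * l ^ M) * bracket 1 ^ M / l) * b' ^ M"
    by (simp add: L_Suc power_mult_distrib algebra_simps flip: l_def b'_def)
  also have "\<dots> = b' ^ M * (b ^ M * q) * ((b + bracket (Suc r))\<^sup>2 + bracket 1 ^ M)"
    unfolding X f using l by (simp add: algebra_simps)
  also have "\<dots> = b' ^ M * bracket_prod r (Suc n) * (b' + bracket (Suc r))\<^sup>2"
    unfolding b' q'[symmetric] by (simp add: power2_eq_square mult_ac)
  finally show ?case
    by (simp only: M_def b'_def c_def)
qed

section \<open>Values in terms of the Carlitz period\<close>

lemma inverse_L_tendsto_0: "(\<lambda>n. 1 / L n) \<longlonglongrightarrow> 0"
  using fls_ord_ge_S[of 1] by (intro fls_tendsto_0I) (simp add: S_1)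

lemma inverse_bracket_tendsto_0: "(\<lambda>n. 1 / bracket n) \<longlonglongrightarrow> 0"
proof (rule fls_tendsto_0I)
  fix n :: nat assume n: "n > 0"
  have "fls_subdegree (bracket n) \<le> - (2 ^ n)"
    by (rule fls_subdegree_leI) (simp add: bracket_nth n)
  moreover have "int n \<le> 2 ^ n"
    using of_nat_mono[OF less_imp_le[OF less_exp[of n]], where 'a = int] by simp
  ultimately have "int n \<le> - fls_subdegree (bracket n)"
    by linarith
  then show "fls_ord_ge (int n) (1 / bracket n)"
    using n by (simp add: fls_ord_ge_iff flip: inverse_eq_divide)
qed

lemma sum_inverse_L_tendsto: "(\<lambda>n. \<Sum>d<n. 1 / L d) \<longlonglongrightarrow> zeta_A 1"
  using zeta_A_tendsto[of 1] by (simp add: S_1)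

lemma zeta_A_two_power: "zeta_A (2 ^ k) = zeta_A 1 ^ 2 ^ k"
proof (rule LIMSEQ_unique)
  show "(\<lambda>n. \<Sum>d<n. 1 / L d ^ 2 ^ k) \<longlonglongrightarrow> zeta_A (2 ^ k)"
    using zeta_A_tendsto[of "2 ^ k"] by (simp add: S_two_power)
  show "(\<lambda>n. \<Sum>d<n. 1 / L d ^ 2 ^ k) \<longlonglongrightarrow> zeta_A 1 ^ 2 ^ k"
    using tendsto_power_fls[OF sum_inverse_L_tendsto, of "2 ^ k"]
    by (simp add: K_inf_sum_power_two_power power_divide)
qed

text \<open>The summand for d = 0 is 1 and all others have positive valuation. Nonvanishing is
  required for convergence of the product defining the period.\<close>

lemma zeta_A_1_neq_0: "zeta_A 1 \<noteq> 0"
proof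
  assume "zeta_A 1 = 0"
  then have "\<forall>\<^sub>F n in sequentially. fls_ord_ge 1 (\<Sum>d<n. 1 / L d)"
    using sum_inverse_L_tendsto by (simp add: tendsto_fls_iff_ord_ge)
  moreover have "\<forall>\<^sub>F n in sequentially. n > (0::nat)"
    by (rule eventually_gt_at_top)
  ultimately have "\<forall>\<^sub>F n in sequentially. n > 0 \<and> fls_ord_ge 1 (\<Sum>d<n. 1 / L d)"
    by eventually_elim simp
  then obtain n where n: "n > 0" "fls_ord_ge 1 (\<Sum>d<n. 1 / L d)"
    by (auto dest: eventually_happens)
  obtain m where m: "n = Suc m"
    using n(1) by (cases n) auto
  have "fls_ord_ge (int (Suc d)) (1 / L (Suc d))" for d
    using fls_ord_ge_S[of 1 "Suc d"] by (simp only: S_1 of_nat_1)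
  then have "fls_ord_ge 1 (1 / L (Suc d))" for d
    by (rule fls_ord_ge_mono) simp
  then have "fls_ord_ge 1 (\<Sum>d<m. 1 / L (Suc d))"
    by (intro fls_ord_ge_sum)
  with n(2) have "fls_ord_ge 1 ((\<Sum>d<n. 1 / L d) - (\<Sum>d<m. 1 / L (Suc d)))"
    by (intro fls_ord_ge_diff)
  then have "fls_ord_ge 1 (1 :: K_inf)"
    unfolding m sum.lessThan_Suc_shift by simp
  then show False
    by (simp add: fls_ord_ge_iff)
qed

lemma bracket_power2_over_L_tendsto: "(\<lambda>n. (bracket n)\<^sup>2 / L n) \<longlonglongrightarrow> bracket 1 * zeta_A 1"
  using tendsto_mult[OF tendsto_const sum_inverse_L_tendsto, of "bracket 1"]
  by (simp only: sum_inverse_L)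

lemma carlitz_partial_product:
  "\<theta>\<^sup>2 * (\<Prod>i<n. inverse (1 - \<theta> powi (1 - 2 ^ Suc i))) = \<theta> ^ 2 ^ Suc n / L n"
proof (induction n)
  case (Suc n)
  have "\<theta> powi (1 - 2 ^ Suc n) = \<theta> / \<theta> ^ 2 ^ Suc n"
    by (simp add: power_int_diff flip: power_int_of_nat)
  then have "1 - \<theta> powi (1 - 2 ^ Suc n) = bracket (Suc n) / \<theta> ^ 2 ^ Suc n"
    by (simp add: bracket_def diff_divide_distrib)
  then have "\<theta>\<^sup>2 * (\<Prod>i<Suc n. inverse (1 - \<theta> powi (1 - 2 ^ Suc i)))
      = \<theta> ^ 2 ^ Suc n / L n * (\<theta> ^ 2 ^ Suc n / bracket (Suc n))"
    using Suc by (simp only: prod.lessThan_Suc mult.assoc[symmetric] inverse_divide)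
  also have "\<dots> = \<theta> ^ 2 ^ Suc (Suc n) / L (Suc n)"
    by (simp only: power_two_Suc[of _ "Suc n"] L_Suc power2_eq_square times_divide_times_eq)
  finally show ?case .
qed (simp add: power2_eq_square)

text \<open>The partial product times \<theta>^2 is ([n]^2 + \<theta>^2)/L_n. Since 1/L_n tends to
  0, it has the same limit as [n]^2/L_n.\<close>

lemma carlitz_period_eq: "carlitz_period = bracket 1 * zeta_A 1"
proof -
  define f where "f i = inverse (1 - \<theta> powi (1 - 2 ^ Suc i))" for i
  define p where "p = bracket 1 * zeta_A 1 / \<theta>\<^sup>2"
  have "\<theta> ^ 2 ^ Suc n = (bracket n)\<^sup>2 + \<theta>\<^sup>2" for n
    by (simp add: power_two_Suc bracket_def K_inf_diff K_inf_add_power2 add.assoc del: power_Suc)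
  then have eq: "(\<Prod>i<n. f i) = ((bracket n)\<^sup>2 / L n + \<theta>\<^sup>2 * (1 / L n)) * (1 / \<theta>\<^sup>2)" for n
    using carlitz_partial_product[of n] by (simp add: f_def field_simps)
  have "(\<lambda>n. \<Prod>i<n. f i) \<longlonglongrightarrow> (bracket 1 * zeta_A 1 + \<theta>\<^sup>2 * 0) * (1 / \<theta>\<^sup>2)"
    unfolding eq
    by (intro tendsto_intros bracket_power2_over_L_tendsto inverse_L_tendsto_0)
  then have "(\<lambda>n. \<Prod>i<n. f i) \<longlonglongrightarrow> p"
    by (simp add: p_def)
  \<comment> \<open>\<open>raw_has_prod\<close> takes products over i \<le> n and demands a nonzero
    limit.\<close>
  then have "(\<lambda>n. \<Prod>i\<le>n. f i) \<longlonglongrightarrow> p"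
    using LIMSEQ_Suc[of "\<lambda>n. \<Prod>i<n. f i" p] by (simp only: lessThan_Suc_atMost)
  moreover have "p \<noteq> 0"
    using zeta_A_1_neq_0 by (simp add: p_def)
  ultimately have "f has_prod p"
    by (simp add: has_prod_def raw_has_prod_def)
  then have "prodinf f = p"
    by (rule has_prod_unique[symmetric])
  then show ?thesis
    by (simp add: carlitz_period_def f_def[abs_def] p_def)
qed

section \<open>Limits of the closed forms\<close>

lemma bracket_ratio_tendsto_1: "(\<lambda>n. 1 + bracket m / bracket n) \<longlonglongrightarrow> 1"
proof -
  have "(\<lambda>n. 1 + bracket m * (1 / bracket n)) \<longlonglongrightarrow> 1 + bracket m * 0"
    by (intro tendsto_intros inverse_bracket_tendsto_0)
  then show ?thesis by simp
qed

text \<open>Each factor [n] + [i] is [n] (1 + [i]/[n]). The exponents of [n] add up to 2 + 4 + ... +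
  2^r = 2^(r+1) - 2, and the factor [n]^2 on the left avoids the subtraction.\<close>

lemma bracket_prod_asymp:
  "\<exists>\<rho>. \<rho> \<longlonglongrightarrow> 1 \<and>
    (\<forall>n>0. bracket_prod r n * (bracket n)\<^sup>2 = bracket n ^ 2 ^ Suc r * \<rho> n)"
proof (induction r)
  case 0
  show ?case by (intro exI[of _ "\<lambda>_. 1"]) simp
next
  case (Suc r)
  then obtain \<rho> where \<rho>: "\<rho> \<longlonglongrightarrow> 1"
    "\<And>n. n > 0 \<Longrightarrow> bracket_prod r n * (bracket n)\<^sup>2 = bracket n ^ 2 ^ Suc r * \<rho> n"
    by blast
  define \<rho>' where "\<rho>' n = (\<rho> n * (1 + bracket (Suc r) / bracket n))\<^sup>2" for n
  have "\<rho>' \<longlonglongrightarrow> (1 * 1)\<^sup>2"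
    unfolding \<rho>'_def by (intro tendsto_power_fls tendsto_mult \<rho>(1) bracket_ratio_tendsto_1)
  moreover have "bracket_prod (Suc r) n * (bracket n)\<^sup>2 = bracket n ^ 2 ^ Suc (Suc r) * \<rho>' n"
    if "n > 0" for n
  proof -
    have "bracket_prod (Suc r) n * (bracket n)\<^sup>2
        = (bracket_prod r n * (bracket n)\<^sup>2 * (1 + bracket (Suc r) / bracket n))\<^sup>2"
      using that by (simp add: power2_eq_square field_simps)
    then show ?thesis
      unfolding \<rho>(2)[OF that] power_two_Suc[of _ "Suc r"] \<rho>'_def
      by (simp add: power_mult_distrib mult_ac)
  qed
  ultimately show ?case
    by (intro exI[of _ \<rho>']) simp
qed

lemma two_powers_ge_1: "s \<in> set (two_powers r) \<Longrightarrow> s \<ge> 1"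
  by auto

text \<open>Multiplying the truncation by w_n = [n]^2/L_n supplies the missing [n]^2 and cancels the
  spare L_n, leaving a power of w_n times a factor tending to 1.\<close>

lemma mzeta_A_two_powers:
  "bracket 1 * zeta_A 1 * mzeta_A (two_powers (Suc r)) * bracket_tower (Suc r)
    = (bracket 1 * zeta_A 1) ^ 2 ^ Suc r"
proof -
  obtain \<rho> where \<rho>: "\<rho> \<longlonglongrightarrow> 1"
    "\<And>n. n > 0 \<Longrightarrow> bracket_prod r n * (bracket n)\<^sup>2 = bracket n ^ 2 ^ Suc r * \<rho> n"
    using bracket_prod_asymp by blast
  define w where "w n = (bracket n)\<^sup>2 / L n" for n
  have w: "w \<longlonglongrightarrow> bracket 1 * zeta_A 1"
    using bracket_power2_over_L_tendsto by (simp add: w_def[abs_def])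
  have eq: "w n * mzeta_trunc (two_powers (Suc r)) n * bracket_tower (Suc r) = w n ^ 2 ^ Suc r * \<rho> n"
    if "n > 0" for n
  proof -
    have "mzeta_trunc (two_powers (Suc r)) n * bracket_tower (Suc r) * L n ^ 2 ^ Suc r * (bracket n)\<^sup>2
        = L n * bracket n ^ 2 ^ Suc r * (bracket_prod r n * (bracket n)\<^sup>2)"
      unfolding mzeta_trunc_two_powers by (simp only: mult.assoc)
    also have "\<dots> = L n * ((bracket n)\<^sup>2) ^ 2 ^ Suc r * \<rho> n"
      unfolding \<rho>(2)[OF that] by (simp add: power2_eq_square power_mult_distrib mult_ac)
    finally show ?thesis
      unfolding w_def power_divide by (simp add: field_simps)
  qed
  have lim: "(\<lambda>n. w n * mzeta_trunc (two_powers (Suc r)) n * bracket_tower (Suc r))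
      \<longlonglongrightarrow> bracket 1 * zeta_A 1 * mzeta_A (two_powers (Suc r)) * bracket_tower (Suc r)"
    by (intro tendsto_mult tendsto_const w mzeta_trunc_tendsto two_powers_ge_1)
  have "(\<lambda>n. w n ^ 2 ^ Suc r * \<rho> n) \<longlonglongrightarrow> (bracket 1 * zeta_A 1) ^ 2 ^ Suc r * 1"
    by (intro tendsto_mult tendsto_power_fls w \<rho>(1))
  then have "(\<lambda>n. w n * mzeta_trunc (two_powers (Suc r)) n * bracket_tower (Suc r))
      \<longlonglongrightarrow> (bracket 1 * zeta_A 1) ^ 2 ^ Suc r * 1"
    by (rule Lim_transform_eventually)
      (use eq in \<open>auto simp: eventually_sequentially intro!: exI[of _ 1]\<close>)
  from LIMSEQ_unique[OF lim this] show ?thesis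
    by (simp only: mult_1_right)
qed

text \<open>The square of [n] + [r+1] in the closed form already supplies the missing [n]^2, so no
  extra factor w_n is needed.\<close>

lemma mzeta_A_1_two_powers:
  "mzeta_A (1 # two_powers (Suc r)) * (bracket 1 ^ 2 ^ Suc r * bracket_tower (Suc r))
    = (bracket 1 * zeta_A 1) ^ 2 ^ Suc r"
proof -
  obtain \<rho> where \<rho>: "\<rho> \<longlonglongrightarrow> 1"
    "\<And>n. n > 0 \<Longrightarrow> bracket_prod r n * (bracket n)\<^sup>2 = bracket n ^ 2 ^ Suc r * \<rho> n"
    using bracket_prod_asymp by blast
  define w where "w n = (bracket n)\<^sup>2 / L n" for n
  define u where "u n = 1 + bracket (Suc r) / bracket n" for n
  define c where "c = bracket 1 ^ 2 ^ Suc r * bracket_tower (Suc r)"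
  have w: "w \<longlonglongrightarrow> bracket 1 * zeta_A 1"
    using bracket_power2_over_L_tendsto by (simp add: w_def[abs_def])
  have u: "u \<longlonglongrightarrow> 1"
    unfolding u_def by (rule bracket_ratio_tendsto_1)
  have eq: "mzeta_trunc (1 # two_powers (Suc r)) n * c = w n ^ 2 ^ Suc r * \<rho> n * (u n)\<^sup>2"
    if "n > 0" for n
  proof -
    have "bracket n + bracket (Suc r) = bracket n * u n"
      using that by (simp add: u_def field_simps)
    then have "mzeta_trunc (1 # two_powers (Suc r)) n * c * L n ^ 2 ^ Suc r
        = bracket n ^ 2 ^ Suc r * (bracket_prod r n * (bracket n)\<^sup>2) * (u n)\<^sup>2"
      unfolding c_def mzeta_trunc_1_two_powers by (simp only: power_mult_distrib mult_ac)
    also have "\<dots> = ((bracket n)\<^sup>2) ^ 2 ^ Suc r * \<rho> n * (u n)\<^sup>2"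
      unfolding \<rho>(2)[OF that] by (simp add: power2_eq_square power_mult_distrib mult_ac)
    finally show ?thesis
      unfolding w_def power_divide by (simp add: field_simps del: mzeta_trunc.simps)
  qed
  have ge_1: "s \<ge> 1" if "s \<in> set (1 # two_powers (Suc r))" for s
    using that by auto
  have lim: "(\<lambda>n. mzeta_trunc (1 # two_powers (Suc r)) n * c)
      \<longlonglongrightarrow> mzeta_A (1 # two_powers (Suc r)) * c"
    by (intro tendsto_mult tendsto_const mzeta_trunc_tendsto ge_1)
  have "(\<lambda>n. w n ^ 2 ^ Suc r * \<rho> n * (u n)\<^sup>2) \<longlonglongrightarrow> (bracket 1 * zeta_A 1) ^ 2 ^ Suc r * 1 * 1\<^sup>2"
    by (intro tendsto_mult tendsto_power_fls w u \<rho>(1))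
  then have "(\<lambda>n. mzeta_trunc (1 # two_powers (Suc r)) n * c)
      \<longlonglongrightarrow> (bracket 1 * zeta_A 1) ^ 2 ^ Suc r * 1 * 1\<^sup>2"
    by (rule Lim_transform_eventually)
      (use eq in \<open>auto simp: eventually_sequentially simp del: mzeta_trunc.simps intro!: exI[of _ 1]\<close>)
  from LIMSEQ_unique[OF lim this] show ?thesis
    by (simp only: c_def mult_1_right power_one)
qed

section \<open>The product relation and the evaluation\<close>

lemma zeta_A_1_mult_mzeta_A:
  assumes "\<And>s. s \<in> set ss \<Longrightarrow> s \<ge> 1" and ts: "map ((*) 2) ts = 2 # ss"
  shows "zeta_A 1 * mzeta_A (1 # 2 # ss) = mzeta_A (1 # 3 # ss) + (mzeta_A (1 # ts))\<^sup>2"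
proof (rule LIMSEQ_unique)
  show "(\<lambda>n. mzeta_trunc [1] n * mzeta_trunc (1 # 2 # ss) n) \<longlonglongrightarrow> zeta_A 1 * mzeta_A (1 # 2 # ss)"
    unfolding mzeta_trunc_1 using assms(1)
    by (intro tendsto_mult sum_inverse_L_tendsto mzeta_trunc_tendsto) auto
  \<comment> \<open>The list 2, 2, ss is the double of 1, ts, so the diagonal term is a
    square.\<close>
  have sq: "mzeta_trunc (2 # 2 # ss) n = (mzeta_trunc (1 # ts) n)\<^sup>2" for n
    using mzeta_trunc_double[of "1 # ts" n] ts by simp
  have "s \<ge> 1" if "s \<in> set ts" for s
  proof -
    have "2 * s \<in> set (2 # ss)"
      unfolding ts[symmetric] using that by auto
    with assms(1)[of "2 * s"] show ?thesis by auto
  qed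
  with assms(1) show "(\<lambda>n. mzeta_trunc [1] n * mzeta_trunc (1 # 2 # ss) n)
      \<longlonglongrightarrow> mzeta_A (1 # 3 # ss) + (mzeta_A (1 # ts))\<^sup>2"
    unfolding mzeta_trunc_1_mult sq
    by (intro tendsto_add tendsto_power_fls mzeta_trunc_tendsto) auto
qed

theorem theorem5p2:
  fixes r :: nat
  assumes "r > 1"
  shows
    "zeta_A 1 * mzeta_A (map (\<lambda>i. 2 ^ i) [0..<r]) =
       mzeta_A (1 # 3 # map (\<lambda>i. 2 ^ i) [2..<r]) +
       (mzeta_A (1 # map (\<lambda>i. 2 ^ i) [0..<r - 1]))\<^sup>2 \<and>
     mzeta_A (1 # 3 # map (\<lambda>i. 2 ^ i) [2..<r]) =
       (bracket r - 1) / (L 1 * bracket r) *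
       (1 / (\<Prod>k = 1..r - 2. bracket k ^ (2 ^ (r - k)))) *
       (carlitz_period ^ (2 ^ r) / L 1 ^ (2 ^ r)) \<and>
     (bracket r - 1) / (L 1 * bracket r) *
       (1 / (\<Prod>k = 1..r - 2. bracket k ^ (2 ^ (r - k)))) *
       (carlitz_period ^ (2 ^ r) / L 1 ^ (2 ^ r)) =
     (bracket r - 1) / (L 1 * bracket r) *
       (1 / (\<Prod>k = 1..r - 2. bracket k ^ (2 ^ (r - k)))) *
       zeta_A (2 ^ r)"
proof (intro conjI)
  define m where "m = r - 2"
  with assms have r: "r = Suc (Suc m)"
    by simp
  let ?H = "map (\<lambda>i. 2 ^ i) [2..<r]"
  have "two_powers r = 1 # 2 # ?H"
    using assms by (simp add: upt_conv_Cons numeral_2_eq_2)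
  moreover have "two_powers r = 1 # map ((*) 2) (two_powers (r - 1))"
    unfolding r two_powers_Suc[of "Suc m"] by simp
  ultimately have H: "two_powers r = 1 # 2 # ?H" "map ((*) 2) (two_powers (r - 1)) = 2 # ?H"
    by simp_all
  show first: "zeta_A 1 * mzeta_A (two_powers r) =
      mzeta_A (1 # 3 # ?H) + (mzeta_A (1 # two_powers (r - 1)))\<^sup>2"
    unfolding H(1) by (rule zeta_A_1_mult_mzeta_A[OF _ H(2)]) auto

  define N where "N = (2::nat) ^ r"
  define \<omega> where "\<omega> = carlitz_period ^ N"
  define P where "P = (\<Prod>k = 1..r - 2. bracket k ^ (2 ^ (r - k)))"
  define b where "b = bracket 1"
  define B where "B = bracket r"
  define C where "C = bracket (Suc m)"
  have nz: "b \<noteq> 0" "B \<noteq> 0" "C \<noteq> 0"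
    by (simp_all add: b_def B_def C_def r)
  \<comment> \<open>The product in the claim stops at r - 2 = m while its exponents are 2^(r-k): a
    fourth power of the tower of height m.\<close>
  have P: "P = bracket_tower m ^ 2 ^ 2" "P \<noteq> 0"
    unfolding P_def using bracket_tower_power[of m 2] by (simp_all add: r)
  have tower: "(bracket_tower (Suc m))\<^sup>2 = P * C\<^sup>2"
    by (simp add: P bracket_tower_Suc power_mult_distrib C_def flip: power_mult)
  have "b * zeta_A 1 * mzeta_A (two_powers r) * (P * C\<^sup>2 * B) = \<omega>"
    using mzeta_A_two_powers[of "Suc m"]
    unfolding bracket_tower_Suc[of "Suc m"] tower
    by (simp only: r[symmetric] b_def B_def \<omega>_def N_def carlitz_period_eq)
  then have F: "zeta_A 1 * mzeta_A (two_powers r) = \<omega> / (b * P * C\<^sup>2 * B)"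
    using nz P(2) by (simp add: field_simps)
  have "(mzeta_A (1 # two_powers (r - 1)))\<^sup>2 * (b ^ N * (P * C\<^sup>2)) = \<omega>"
    using arg_cong[OF mzeta_A_1_two_powers[of m], of "\<lambda>x. x\<^sup>2"]
    unfolding power_mult_distrib tower power_two_Suc[of _ "Suc m", symmetric]
    by (simp add: r b_def \<omega>_def N_def carlitz_period_eq power_mult_distrib del: power_Suc upt_Suc)
  then have G: "(mzeta_A (1 # two_powers (r - 1)))\<^sup>2 = \<omega> / (b ^ N * P * C\<^sup>2)"
    using nz P(2) by (simp add: field_simps)
  have bN: "b ^ N = B\<^sup>2 + b + B"
    unfolding b_def N_def bracket_1_power bracket_Suc[of r] B_def by simp
  have C2: "C\<^sup>2 = B + b"
    unfolding C_def B_def r bracket_Suc[of "Suc m"] b_def by (simp add: add.assoc)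
  \<comment> \<open>This produces the numerator [r] - 1: both sides are B^2 + b B + B + b in
    characteristic 2, and C^2 then cancels.\<close>
  have key: "(B - 1) * C\<^sup>2 = b ^ N + b * B"
    unfolding bN C2 K_inf_diff by algebra
  \<comment> \<open>The product relation is solved for this value; subtraction is addition in
    characteristic 2.\<close>
  have "mzeta_A (1 # 3 # ?H) = \<omega> / (b * P * C\<^sup>2 * B) + \<omega> / (b ^ N * P * C\<^sup>2)"
    using first unfolding F G by (simp add: add.assoc)
  also have "\<dots> = \<omega> * (b ^ N + b * B) / (b * P * C\<^sup>2 * B * b ^ N)"
    using nz P(2) by (simp add: divide_simps) (simp add: algebra_simps)
  also have "\<dots> = (B - 1) / (b * B) * (1 / P) * (\<omega> / b ^ N)"
    unfolding key[symmetric] using nz P(2) by (simp add: field_simps)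
  finally show "mzeta_A (1 # 3 # ?H) =
      (bracket r - 1) / (L 1 * bracket r) *
      (1 / (\<Prod>k = 1..r - 2. bracket k ^ (2 ^ (r - k)))) *
      (carlitz_period ^ (2 ^ r) / L 1 ^ (2 ^ r))"
    by (simp add: B_def b_def P_def \<omega>_def N_def L_def)
next
  \<comment> \<open>The period is L_1 times \<open>zeta_A 1\<close>, and by Frobenius the power of
    \<open>zeta_A 1\<close> is \<open>zeta_A (2 ^ r)\<close>.\<close>
  have "carlitz_period ^ (2 ^ r) / L 1 ^ (2 ^ r) = zeta_A (2 ^ r)"
    by (simp add: carlitz_period_eq zeta_A_two_power L_def power_mult_distrib)
  then show "(bracket r - 1) / (L 1 * bracket r) *
       (1 / (\<Prod>k = 1..r - 2. bracket k ^ (2 ^ (r - k)))) *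
       (carlitz_period ^ (2 ^ r) / L 1 ^ (2 ^ r)) =
     (bracket r - 1) / (L 1 * bracket r) *
       (1 / (\<Prod>k = 1..r - 2. bracket k ^ (2 ^ (r - k)))) *
       zeta_A (2 ^ r)"
    by simp
qed

end
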